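(* Let $r\ge 1$ be an integer, let $m,k_1,\ldots,k_{r-1}\in\mathbb{N}_0$ with $m\ge k_1+k_2+\cdots+k_{r-1}$, and put $k_r:=m-k_1-k_2-\cdots-k_{r-1}$. Let $\beta_1,\ldots,\beta_r\in\mathbb{C}$ be such that none of the numbers $\beta_1,\ldots,\beta_r$ and $\beta_1-k_1,\ldots,\beta_r-k_r$ is zero or a negative integer. Then $$ {}_{r+1}F_r\!\left[\begin{matrix}-m,\ \beta_1,\ \beta_2,\ldots,\beta_r\\ \beta_1-k_1,\ \beta_2-k_2,\ldots,\beta_{r-1}-k_{r-1},\ \beta_r-(m-k_1-k_2-\cdots-k_{r-1})\end{matrix};1\right] =\frac{m!}{(1-\beta_1)_{k_1}(1-\beta_2)_{k_2}\cdots(1-\beta_{r-1})_{k_{r-1}}(1-\beta_r)_{m-k_1-k_2-\cdots-k_{r-1}}}. $$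
   Context: $\mathbb{N}_0$ denotes the nonnegative integers. Shifted factorial: $(\alpha)_0=1$ and $(\alpha)_n=\prod_{i=0}^{n-1}(\alpha+i)$ for $n\ge1$. For $m\in\mathbb{N}_0$, the terminating hypergeometric series at argument $1$ is the finite sum $$ {}_{r+1}F_r\!\left[\begin{matrix}-m,\ a_1,\ldots,a_r\\ c_1,\ldots,c_r\end{matrix};1\right]=\sum_{k=0}^{m}\frac{(-m)_k(a_1)_k\cdots(a_r)_k}{(c_1)_k\cdots(c_r)_k}\frac{1}{k!}. $$ *)

theory Defs
  imports Complex_Main "HOL-Library.Nonpos_Ints"
begin

text \<open>
  The terminating series with \<open>r + 1\<close> upper parameters \<open>-m, a 1, \<dots>, a r\<close> and \<open>r\<close> lower
  parameters \<open>c 1, \<dots>, c r\<close>, evaluated at argument 1. Both parameter families are read only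
  at the indices \<open>1, \<dots>, r\<close>. The sum is cut off at \<open>m\<close> explicitly. If some \<open>c i\<close> is a
  nonpositive integer, division by zero makes the affected terms 0, so the value is then
  meaningless.
\<close>
definition hypergeo_at_1 :: "nat \<Rightarrow> nat \<Rightarrow> (nat \<Rightarrow> complex) \<Rightarrow> (nat \<Rightarrow> complex) \<Rightarrow> complex" where
  "hypergeo_at_1 r m a c =
     (\<Sum>j=0..m. pochhammer (- of_nat m) j * (\<Prod>i=1..r. pochhammer (a i) j)
                 / (\<Prod>i=1..r. pochhammer (c i) j) * (1 / fact j))"

end

theory Submission imports Defs begin

text \<open>
  Each quotient \<open>(\<beta>)\<^sub>j / (\<beta> - k)\<^sub>j\<close> equals \<open>(\<beta> - k + j)\<^sub>k / (\<beta> - k)\<^sub>k\<close>, whose numerator is a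
  monic polynomial of degree \<open>k\<close> in \<open>j\<close>. The \<open>k i\<close> add up to \<open>m\<close>, so, up to a factor that
  does not depend on \<open>j\<close>, the \<open>j\<close>-th term of the series is \<open>(-1)\<^sup>j (m choose j) P(j)\<close> with \<open>P\<close>
  monic of degree exactly \<open>m\<close>. The series is therefore \<open>(-1)\<^sup>m\<close> times an \<open>m\<close>-th finite
  difference of \<open>P\<close>, which sees only the leading coefficient and gives \<open>m!\<close>
  (\<open>alternating_binomial_sum_prod_linear\<close>). The sign \<open>(-1)\<^sup>m\<close> cancels against those in
  \<open>(\<beta> - k)\<^sub>k = (-1)\<^sup>k (1 - \<beta>)\<^sub>k\<close>.
\<close>

text \<open>
  Absorption, \<open>j (m + 1 choose j) = (m + 1) (m choose j - 1)\<close>: multiplying the summand by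
  the variable lowers the order of the difference by one and shifts the function.
\<close>
lemma alternating_binomial_sum_times_index:
  fixes f :: "nat \<Rightarrow> 'a::comm_ring_1"
  shows "(\<Sum>j\<le>Suc m. (-1) ^ j * of_nat (Suc m choose j) * (of_nat j * f j))
           = - of_nat (Suc m) * (\<Sum>j\<le>m. (-1) ^ j * of_nat (m choose j) * f (Suc j))"
proof -
  have absorb: "of_nat (Suc m choose Suc j) * of_nat (Suc j)
                  = (of_nat (Suc m) * of_nat (m choose j) :: 'a)" for j
    by (metis Suc_times_binomial mult.commute of_nat_mult)
  have "(\<Sum>j\<le>Suc m. (-1) ^ j * of_nat (Suc m choose j) * (of_nat j * f j))
          = (\<Sum>j\<le>m. (-1) ^ Suc j * (of_nat (Suc m choose Suc j) * of_nat (Suc j)) * f (Suc j))"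
    by (subst sum.atMost_Suc_shift) (simp only: of_nat_0 mult_zero_left mult_zero_right add_0 mult.assoc)
  also have "\<dots> = - of_nat (Suc m) * (\<Sum>j\<le>m. (-1) ^ j * of_nat (m choose j) * f (Suc j))"
    unfolding absorb sum_distrib_left by (rule sum.cong) (simp_all add: algebra_simps)
  finally show ?thesis .
qed

text \<open>
  Lower degrees are included because the induction removes one factor \<open>j + c\<close> at a time: its
  constant part leaves a product of too low a degree, which contributes nothing, while its
  linear part reduces the order and the degree together.
\<close>
lemma alternating_binomial_sum_prod_linear:
  fixes c :: "'b \<Rightarrow> 'a::{comm_ring_1, semiring_char_0}"
  assumes "finite A" and "card A \<le> m"
  shows "(\<Sum>j\<le>m. (-1) ^ j * of_nat (m choose j) * (\<Prod>x\<in>A. of_nat j + c x))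
           = (if card A = m then (-1) ^ m * fact m else 0)"
  using assms
proof (induction A arbitrary: m c rule: finite_induct)
  case empty
  show ?case
  proof (cases "m = 0")
    case False
    then show ?thesis using choose_alternating_sum[of m, where ?'a = 'a] by simp
  qed simp
next
  case (insert y A)
  from insert.hyps insert.prems obtain n where m: "m = Suc n" and n: "card A \<le> n"
    by (cases m) auto
  define P where "P j = (\<Prod>x\<in>A. of_nat j + c x)" for j :: nat
  have "(\<Sum>j\<le>m. (-1) ^ j * of_nat (m choose j) * (\<Prod>x\<in>insert y A. of_nat j + c x))
          = (\<Sum>j\<le>m. (-1) ^ j * of_nat (m choose j) * (of_nat j * P j))
              + c y * (\<Sum>j\<le>m. (-1) ^ j * of_nat (m choose j) * P j)"
    unfolding sum_distrib_left sum.distrib[symmetric] P_def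
    using insert.hyps by (intro sum.cong) (simp_all add: algebra_simps)
  also have "(\<Sum>j\<le>m. (-1) ^ j * of_nat (m choose j) * P j) = 0"
    unfolding P_def using insert.IH[of m c] n m by simp
  also have "(\<Sum>j\<le>m. (-1) ^ j * of_nat (m choose j) * (of_nat j * P j))
          = - of_nat (Suc n) * (\<Sum>j\<le>n. (-1) ^ j * of_nat (n choose j) * P (Suc j))"
    unfolding m by (rule alternating_binomial_sum_times_index)
  also have "(\<Sum>j\<le>n. (-1) ^ j * of_nat (n choose j) * P (Suc j))
          = (if card A = n then (-1) ^ n * fact n else 0)"
    unfolding P_def using insert.IH[of n "\<lambda>x. c x + 1"] n by (simp add: add_ac)
  also have "- of_nat (Suc n) * (if card A = n then (-1) ^ n * fact n else 0) + c y * 0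
          = (if card (insert y A) = m then (-1) ^ m * fact m else 0)"
    using insert.hyps m by (simp add: algebra_simps)
  finally show ?case .
qed

text \<open>
  Splitting the \<open>j + k\<close> factors of \<open>(b - k)\<^bsub>j+k\<^esub>\<close> after the first \<open>k\<close> or after the first \<open>j\<close>
  gives \<open>(b - k)\<^sub>k (b)\<^sub>j = (b - k)\<^sub>j (b - k + j)\<^sub>k\<close>. The quotient thereby becomes a polynomial
  in \<open>j\<close>, of a degree that does not depend on \<open>j\<close>.
\<close>
lemma pochhammer_quotient_integer_shift:
  fixes b :: "'a::field_char_0"
  assumes "b - of_nat k \<notin> \<int>\<^sub>\<le>\<^sub>0"
  shows "pochhammer b j / pochhammer (b - of_nat k) j
           = pochhammer (b - of_nat k + of_nat j) k / ((-1) ^ k * pochhammer (1 - b) k)"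
proof -
  have nz: "pochhammer (b - of_nat k) n \<noteq> 0" for n
    using assms by (auto simp: pochhammer_eq_0_iff)
  have "pochhammer (b - of_nat k) k * pochhammer b j
          = pochhammer (b - of_nat k) j * pochhammer (b - of_nat k + of_nat j) k"
    using pochhammer_product'[of "b - of_nat k" k j] pochhammer_product'[of "b - of_nat k" j k]
    by (simp add: add.commute)
  moreover have "pochhammer (b - of_nat k) k = (-1) ^ k * pochhammer (1 - b) k"
    using pochhammer_minus[of "of_nat k - b" k] by simp
  ultimately show ?thesis
    using nz[of j] nz[of k] by (simp add: field_simps)
qed

theorem theorem3p6:
  fixes r m :: nat and k :: "nat \<Rightarrow> nat" and \<beta> :: "nat \<Rightarrow> complex"
  assumes "r \<ge> 1"
    and "m \<ge> (\<Sum>i=1..r-1. k i)"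
    and "k r = m - (\<Sum>i=1..r-1. k i)"
    and "\<And>i. i \<in> {1..r} \<Longrightarrow> \<beta> i \<notin> \<int>\<^sub>\<le>\<^sub>0"
    and "\<And>i. i \<in> {1..r} \<Longrightarrow> \<beta> i - of_nat (k i) \<notin> \<int>\<^sub>\<le>\<^sub>0"
  shows "hypergeo_at_1 r m \<beta> (\<lambda>i. \<beta> i - of_nat (k i))
           = fact m / (\<Prod>i=1..r. pochhammer (1 - \<beta> i) (k i))"
proof -
  have sum_k: "(\<Sum>i=1..r. k i) = m"
    using assms(1-3) by (cases r) auto
  \<comment> \<open>An index for every linear factor in \<open>j\<close> of the product of the \<open>(\<beta> i - k i + j)\<close> rising
      to length \<open>k i\<close>, so that the degree in \<open>j\<close> is the cardinality of \<open>A\<close>.\<close>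
  define A where "A = Sigma {1..r} (\<lambda>i. {0..<k i})"
  define c where "c = (\<lambda>(i, l). \<beta> i - of_nat (k i) + of_nat l)"
  define D where "D = (\<Prod>i=1..r. pochhammer (1 - \<beta> i) (k i))"
  have A: "finite A" "card A = m"
    using sum_k by (auto simp: A_def)
  have numerator: "(\<Prod>i=1..r. pochhammer (\<beta> i - of_nat (k i) + of_nat j) (k i))
                     = (\<Prod>x\<in>A. of_nat j + c x)" for j
    unfolding A_def c_def pochhammer_prod
    by (subst prod.Sigma) (auto intro!: prod.cong simp: add_ac)
  have quotient: "(\<Prod>i=1..r. pochhammer (\<beta> i) j) / (\<Prod>i=1..r. pochhammer (\<beta> i - of_nat (k i)) j)
                    = (\<Prod>x\<in>A. of_nat j + c x) / ((-1) ^ m * D)" for j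
  proof -
    have "(\<Prod>i=1..r. pochhammer (\<beta> i) j) / (\<Prod>i=1..r. pochhammer (\<beta> i - of_nat (k i)) j)
            = (\<Prod>i=1..r. pochhammer (\<beta> i - of_nat (k i) + of_nat j) (k i)
                 / ((-1) ^ k i * pochhammer (1 - \<beta> i) (k i)))"
      unfolding prod_dividef[symmetric]
      by (intro prod.cong refl pochhammer_quotient_integer_shift assms(5))
    also have "\<dots> = (\<Prod>x\<in>A. of_nat j + c x) / ((-1) ^ m * D)"
      unfolding prod_dividef prod.distrib numerator D_def power_sum[symmetric] sum_k ..
    finally show ?thesis .
  qed
  have binomial: "pochhammer (- of_nat m) j * (1 / fact j)
                    = (-1) ^ j * (of_nat (m choose j) :: complex)" for j
    by (simp add: binomial_gbinomial gbinomial_pochhammer flip: power_add mult.assoc)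
  have "hypergeo_at_1 r m \<beta> (\<lambda>i. \<beta> i - of_nat (k i))
          = (\<Sum>j\<le>m. (pochhammer (- of_nat m) j * (1 / fact j))
                * ((\<Prod>i=1..r. pochhammer (\<beta> i) j) / (\<Prod>i=1..r. pochhammer (\<beta> i - of_nat (k i)) j)))"
    unfolding hypergeo_at_1_def by (simp add: atLeast0AtMost mult_ac)
  also have "\<dots> = (\<Sum>j\<le>m. (-1) ^ j * of_nat (m choose j) * (\<Prod>x\<in>A. of_nat j + c x)) / ((-1) ^ m * D)"
    unfolding binomial quotient by (simp add: sum_divide_distrib)
  also have "\<dots> = fact m / D"
    using alternating_binomial_sum_prod_linear[of A m c] A by simp
  finally show ?thesis unfolding D_def .
qed

end
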